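(* Let $D$ be an $n$-vertex digraph whose strongly connected components, listed in a topological order, are $C_1,\ldots,C_t$, and let $k$ be an integer with $2\le k\le n-2$. Then $F_k(D)$ is unilateral if and only if $D$ is unilateral and either $t\le 2$, or $t=3$ and $|C_2|=1$.
   Context: A digraph $D$ has a finite vertex set $V(D)$ and a set $A(D)$ of arcs, which are ordered pairs of distinct vertices (both $(x,y)$ and $(y,x)$ may be arcs). For a digraph $D$ of order $n$ and $1 \le k \le n-1$, the $k$-token digraph $F_k(D)$ has as vertices all $k$-subsets of $V(D)$, and $(A,B)$ is an arc of $F_k(D)$ whenever $A\setminus B=\{a\}$, $B\setminus A=\{b\}$ and $(a,b)\in A(D)$. A digraph is unilateral if for every pair of vertices $x,y$ there is a directed path from $x$ to $y$ or a directed path from $y$ to $x$ (or both). Strongly connected components are the maximal strongly connected subdigraphs, and $|C_i|$ is the number of vertices of $C_i$. The order $C_1,\ldots,C_t$ is topological if every arc of $D$ between distinct components goes from some $C_i$ to some $C_j$ with $i<j$. *)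

theory Defs
  imports "Graph_Theory.Digraph_Component"
begin

definition token_digraph :: "nat \<Rightarrow> 'a pair_pre_digraph \<Rightarrow> 'a set pair_pre_digraph" where
  "token_digraph k D =
    \<lparr> pverts = {A. A \<subseteq> pverts D \<and> card A = k},
      parcs = {(A, B). A \<subseteq> pverts D \<and> card A = k \<and> B \<subseteq> pverts D \<and> card B = k \<and>
                 (\<exists>a b. A - B = {a} \<and> B - A = {b} \<and> (a, b) \<in> parcs D)} \<rparr>"

definition unilateral :: "('a, 'b) pre_digraph \<Rightarrow> bool" where
  "unilateral G \<longleftrightarrow> (\<forall>x \<in> verts G. \<forall>y \<in> verts G. x \<rightarrow>\<^sup>*\<^bsub>G\<^esub> y \<or> y \<rightarrow>\<^sup>*\<^bsub>G\<^esub> x)"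

(* List positions count from 0: the component C_i is Cs ! (i - 1). *)
definition topological_sccs :: "('a, 'b) pre_digraph \<Rightarrow> ('a, 'b) pre_digraph list \<Rightarrow> bool" where
  "topological_sccs G Cs \<longleftrightarrow>
    distinct Cs \<and> set Cs = pre_digraph.sccs G \<and>
    (\<forall>i < length Cs. \<forall>j < length Cs. \<forall>u \<in> verts (Cs ! i). \<forall>v \<in> verts (Cs ! j).
      i \<noteq> j \<longrightarrow> u \<rightarrow>\<^bsub>G\<^esub> v \<longrightarrow> i < j)"

end

theory Submission
  imports Defs
begin

text \<open>
  Think of a vertex of the token digraph as \<open>k\<close> indistinguishable tokens on distinct vertices of
  \<open>D\<close>, an arc moving one token along an arc of \<open>D\<close> to an empty vertex.

  What one can do: if \<open>b\<close> is empty and reachable from an occupied \<open>a\<close>, then the tokens can be moved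
  so that the net effect is to carry the token from \<open>a\<close> to \<open>b\<close> (\<open>token_slide\<close>). Tokens that stand in
  the way are no obstacle: the blocking token makes the rest of the journey, and the blocked one
  takes its place. Hence \<open>A\<close> reaches \<open>B\<close> as soon as some bijection from \<open>A - B\<close> to \<open>B - A\<close> sends
  every vertex to one that it reaches (\<open>token_transport\<close>).

  What one cannot do: a set \<open>U\<close> of vertices that no arc leaves never loses a token
  (\<open>token_count_mono\<close>). So two configurations are incomparable if one has more tokens in some such
  \<open>U\<close> and the other has more in another such set \<open>W\<close>. Two vertices \<open>x\<close>, \<open>y\<close> neither of which reaches
  the other give such a pair, with one token on \<open>x\<close> or on \<open>y\<close>; so \<open>D\<close> must be unilateral. Write
  \<open>u < v\<close> when \<open>u\<close> reaches \<open>v\<close> but not conversely. Distinct vertices \<open>v\<close>, \<open>w\<close> with \<open>x < v\<close>, \<open>x < w\<close>,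
  \<open>v < z\<close>, \<open>w < z\<close> give another such pair, with two tokens on \<open>x\<close>, \<open>z\<close> or on \<open>v\<close>, \<open>w\<close>; the bounds
  on \<open>k\<close> leave room for the remaining tokens.

  These are the only obstructions. If \<open>D\<close> is unilateral, then \<open>u\<close> reaches \<open>v\<close> exactly when the
  component of \<open>u\<close> is not listed after that of \<open>v\<close>. List \<open>A - B\<close> and \<open>B - A\<close> in the order of their
  components and match equal positions. If this matching works in neither direction, then it fails
  at two positions in opposite ways, and the four vertices found there form an obstruction of the
  second kind (\<open>rank_matching\<close>).

  Finally, in a unilateral \<open>D\<close>, two distinct vertices lie between two others exactly when the components
  other than the first and the last have at least two vertices in total, that is, when \<open>t \<ge> 4\<close>, or
  \<open>t = 3\<close> and the middle component has more than one vertex.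
\<close>

section \<open>Moving tokens\<close>

lemma wf_token_digraph: "pair_wf_digraph (token_digraph k D)"
  by unfold_locales (auto simp: token_digraph_def)

lemma verts_token_digraph [simp]:
  "pverts (token_digraph k D) = {A. A \<subseteq> pverts D \<and> card A = k}"
  by (simp add: token_digraph_def)

lemma card_exchange:
  assumes "finite A" "a \<in> A" "b \<notin> A"
  shows "card (insert b (A - {a})) = card A"
  using assms card_Suc_Diff1[of A a] by simp

lemma token_move:
  assumes "pair_fin_digraph D" "A \<subseteq> pverts D" "card A = k" "a \<in> A" "b \<notin> A" "(a, b) \<in> parcs D"
  shows "(A, insert b (A - {a})) \<in> parcs (token_digraph k D)"
proof -
  interpret pair_fin_digraph D by fact
  have fin: "finite A" using assms(2) by (rule finite_subset[OF _ pair_finite_verts])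
  have "b \<in> pverts D" using assms(6) by (rule in_arcsD2)
  moreover have "card (insert b (A - {a})) = k"
    using card_exchange[OF fin assms(4,5)] assms(3) by simp
  moreover have "A - insert b (A - {a}) = {a}" "insert b (A - {a}) - A = {b}"
    using assms by auto
  ultimately show ?thesis
    using assms unfolding token_digraph_def by auto
qed

text \<open>
  Induction along the walk from \<open>a\<close> to \<open>b\<close>. If the next vertex \<open>c\<close> is empty, the token steps
  to \<open>c\<close> and goes on from there. If \<open>c\<close> is occupied, then first the token on \<open>c\<close> is carried to \<open>b\<close>,
  which makes room for the one on \<open>a\<close> to step to \<open>c\<close>. This needs the induction hypothesis
  for other configurations than \<open>A\<close>.
\<close>
lemma token_slide:
  assumes D: "pair_fin_digraph D" and reach: "a \<rightarrow>\<^sup>*\<^bsub>with_proj D\<^esub> b"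
    and "A \<subseteq> pverts D" "card A = k" "a \<in> A" "b \<notin> A"
  shows "A \<rightarrow>\<^sup>*\<^bsub>with_proj (token_digraph k D)\<^esub> insert b (A - {a})"
proof -
  interpret pair_fin_digraph D by fact
  interpret T: pair_wf_digraph "token_digraph k D" by (rule wf_token_digraph)
  let ?T = "with_proj (token_digraph k D)"
  show ?thesis
    using reach assms(3-)
  proof (induction a arbitrary: A rule: converse_reachable_induct)
    case base
    then show ?case by simp
  next
    case (step a c)
    have arc: "(a, c) \<in> parcs D" using step.hyps(1) by simp
    have c: "c \<in> pverts D" using arc by (rule in_arcsD2)
    have b: "b \<in> pverts D" using step.hyps(2) by (auto dest: reachable_in_verts)
    have finA: "finite A" using step.prems(1) by (rule finite_subset[OF _ pair_finite_verts])
    show ?case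
    proof (cases "c \<in> A")
      case False
      let ?A = "insert c (A - {a})"
      have move: "(A, ?A) \<in> parcs (token_digraph k D)"
        using token_move[OF D step.prems(1,2,3) False arc] .
      show ?thesis
      proof (cases "b = c")
        case True
        then show ?thesis using T.reachable_adjI[OF move] by simp
      next
        case bc: False
        have "card ?A = k"
          using card_exchange[OF finA step.prems(3) False] step.prems(2) by simp
        then have "?A \<rightarrow>\<^sup>*\<^bsub>?T\<^esub> insert b (?A - {c})"
          using step.prems c bc by (intro step.IH) auto
        moreover have "?A - {c} = A - {a}" using False by auto
        ultimately show ?thesis using T.adj_reachable_trans[OF move] by simp
      qed
    next
      case True
      show ?thesis
      proof (cases "a = c")
        case True
        then show ?thesis using step by simp
      next
        case ac: False
        let ?A = "insert b (A - {c})"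
        have "A \<rightarrow>\<^sup>*\<^bsub>?T\<^esub> ?A" using step.IH[of A] step.prems True by simp
        moreover have "(?A, insert c (?A - {a})) \<in> parcs (token_digraph k D)"
        proof (rule token_move[OF D _ _ _ _ arc])
          show "card ?A = k" using card_exchange[OF finA True step.prems(4)] step.prems(2) by simp
        qed (use step.prems True ac b in auto)
        moreover have "insert c (?A - {a}) = insert b (A - {a})"
          using ac True step.prems by auto
        ultimately show ?thesis using T.reachable_adj_trans by simp
      qed
    qed
  qed
qed

text \<open>
  The pairs of the bijection can be served one at a time: carrying a token from \<open>a\<close> to \<open>f a\<close> removes
  \<open>a\<close> from \<open>A - B\<close> and \<open>f a\<close> from \<open>B - A\<close>, and leaves the rest of the bijection in force.
\<close>
lemma token_transport:
  assumes D: "pair_fin_digraph D" and "A \<subseteq> pverts D" "card A = k" "B \<subseteq> pverts D"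
    and "bij_betw f (A - B) (B - A)"
    and "\<And>a. a \<in> A - B \<Longrightarrow> a \<rightarrow>\<^sup>*\<^bsub>with_proj D\<^esub> f a"
  shows "A \<rightarrow>\<^sup>*\<^bsub>with_proj (token_digraph k D)\<^esub> B"
proof -
  interpret pair_fin_digraph D by fact
  interpret T: pair_wf_digraph "token_digraph k D" by (rule wf_token_digraph)
  show ?thesis
    using assms(2-)
  proof (induction "card (A - B)" arbitrary: A)
    case 0
    have "finite A" using \<open>A \<subseteq> pverts D\<close> by (rule finite_subset[OF _ pair_finite_verts])
    with 0(1) have AB: "A - B = {}" by simp
    then have "B - A = {}" using 0 by (auto simp: bij_betw_def)
    with AB have "A = B" by auto
    then show ?case using 0 by simp
  next
    case (Suc m)
    have fin: "finite A" using Suc.prems(1) by (rule finite_subset[OF _ pair_finite_verts])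
    obtain a where a: "a \<in> A - B" using Suc(2) by (metis card.empty ex_in_conv nat.distinct(1))
    have fa: "f a \<in> B - A" using Suc.prems(4) a by (auto simp: bij_betw_def)
    let ?A = "insert (f a) (A - {a})"
    have diffs: "?A - B = A - B - {a}" "B - ?A = B - A - {f a}" using a fa by auto
    have "A \<rightarrow>\<^sup>*\<^bsub>with_proj (token_digraph k D)\<^esub> ?A"
      using token_slide[OF D Suc.prems(5)[OF a] Suc.prems(1,2)] a fa by auto
    also have "?A \<rightarrow>\<^sup>*\<^bsub>with_proj (token_digraph k D)\<^esub> B"
    proof (rule Suc.hyps(1))
      show "m = card (?A - B)" using Suc(2) a fin by (simp add: diffs)
      show "card ?A = k" using card_exchange[of A a "f a"] Suc.prems(2) a fa fin by simp
      show "bij_betw f (?A - B) (B - ?A)"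
        unfolding diffs by (rule bij_betw_DiffI[OF Suc.prems(4)]) (use a fa in auto)
      show "\<And>x. x \<in> ?A - B \<Longrightarrow> x \<rightarrow>\<^sup>*\<^bsub>with_proj D\<^esub> f x"
        using Suc.prems(5) by (simp add: diffs)
    qed (use Suc.prems fa in auto)
    finally show ?case .
  qed
qed

section \<open>Obstructions to reachability\<close>

text \<open>A token that has entered a set that no arc leaves stays in it.\<close>
lemma token_count_mono:
  assumes D: "pair_fin_digraph D"
    and closed: "\<And>u v. u \<in> U \<Longrightarrow> (u, v) \<in> parcs D \<Longrightarrow> v \<in> U"
    and "A \<rightarrow>\<^sup>*\<^bsub>with_proj (token_digraph k D)\<^esub> B"
  shows "card (A \<inter> U) \<le> card (B \<inter> U)"
proof -
  interpret pair_fin_digraph D by fact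
  interpret T: pair_wf_digraph "token_digraph k D" by (rule wf_token_digraph)
  show ?thesis
    using assms(3)
  proof (induction rule: T.reachable_induct)
    case (step B C)
    obtain b c where bc: "B - C = {b}" "C - B = {c}" "(b, c) \<in> parcs D"
      and sub: "B \<subseteq> pverts D" "C \<subseteq> pverts D"
      using step(2) by (auto simp: token_digraph_def)
    have fin: "finite B" "finite C" using sub by (simp_all add: finite_subset[OF _ pair_finite_verts])
    have split: "card (X \<inter> U) = card (B \<inter> C \<inter> U) + card ((X - Y) \<inter> U)"
      if "finite X" "X \<inter> Y = B \<inter> C" for X Y
    proof -
      have "card (X \<inter> U) = card ((B \<inter> C \<inter> U) \<union> ((X - Y) \<inter> U))"
        using that by (intro arg_cong[where f=card]) auto
      also have "\<dots> = card (B \<inter> C \<inter> U) + card ((X - Y) \<inter> U)"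
        using that fin by (intro card_Un_disjoint) auto
      finally show ?thesis .
    qed
    have "card ({b} \<inter> U) \<le> card ({c} \<inter> U)"
      using closed[OF _ bc(3)] by (cases "b \<in> U") auto
    then have "card (B \<inter> U) \<le> card (C \<inter> U)"
      using split[of B C] split[of C B] fin bc by (simp add: Int_commute)
    with step show ?case by simp
  qed simp
qed

text \<open>
  The incomparable configurations are \<open>X \<union> P\<close> and \<open>X \<union> Q\<close>, where \<open>X\<close> is any set of the right size
  that avoids \<open>P\<close> and \<open>Q\<close>: its tokens contribute equally to both counts in \<open>U\<close> and in \<open>W\<close>.
\<close>
lemma not_unilateral_token_digraph:
  assumes D: "pair_fin_digraph D"
    and PQ: "P \<subseteq> pverts D" "Q \<subseteq> pverts D" "P \<inter> Q = {}" "card P = card Q"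
    and k: "card P \<le> k" "k + card P \<le> card (pverts D)"
    and U: "\<And>u v. u \<in> U \<Longrightarrow> (u, v) \<in> parcs D \<Longrightarrow> v \<in> U" "card (Q \<inter> U) < card (P \<inter> U)"
    and W: "\<And>u v. u \<in> W \<Longrightarrow> (u, v) \<in> parcs D \<Longrightarrow> v \<in> W" "card (P \<inter> W) < card (Q \<inter> W)"
  shows "\<not> unilateral (with_proj (token_digraph k D))"
proof -
  interpret pair_fin_digraph D by fact
  have fin: "finite P" "finite Q" using PQ by (simp_all add: finite_subset[OF _ pair_finite_verts])
  have "card (pverts D - (P \<union> Q)) = card (pverts D) - (card P + card Q)"
    using PQ fin by (simp add: card_Diff_subset card_Un_disjoint)
  then have "k - card P \<le> card (pverts D - (P \<union> Q))" using k PQ by simp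
  then obtain X where X: "X \<subseteq> pverts D - (P \<union> Q)" "card X = k - card P" "finite X"
    using obtain_subset_with_card_n by metis
  have count: "card ((X \<union> R) \<inter> S) = card (X \<inter> S) + card (R \<inter> S)"
    if "finite R" "R \<subseteq> P \<union> Q" for R S
    unfolding Int_Un_distrib2 using that X by (intro card_Un_disjoint) auto
  have "card (X \<union> P) = k" "card (X \<union> Q) = k"
    using count[of P UNIV] count[of Q UNIV] fin X k PQ by auto
  then have "X \<union> P \<in> verts (with_proj (token_digraph k D))"
      "X \<union> Q \<in> verts (with_proj (token_digraph k D))"
    using X PQ by auto
  moreover have "\<not> (X \<union> P) \<rightarrow>\<^sup>*\<^bsub>with_proj (token_digraph k D)\<^esub> (X \<union> Q)"
    using token_count_mono[OF D U(1), where A = "X \<union> P" and B = "X \<union> Q" and k = k] count[of P U] count[of Q U] U(2) fin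
    by auto
  moreover have "\<not> (X \<union> Q) \<rightarrow>\<^sup>*\<^bsub>with_proj (token_digraph k D)\<^esub> (X \<union> P)"
    using token_count_mono[OF D W(1), where A = "X \<union> Q" and B = "X \<union> P" and k = k] count[of P W] count[of Q W] W(2) fin
    by auto
  ultimately show ?thesis unfolding unilateral_def by blast
qed

text \<open>
  If neither of \<open>x\<close>, \<open>y\<close> reaches the other, a token on \<open>x\<close> and a token on \<open>y\<close> are told apart by the
  set of vertices reachable from \<open>x\<close> in one direction and by that reachable from \<open>y\<close> in the other.
\<close>
lemma unilateral_of_token_digraph:
  assumes D: "pair_fin_digraph D" and k: "1 \<le> k" "k < card (pverts D)"
    and uni: "unilateral (with_proj (token_digraph k D))"
  shows "unilateral (with_proj D)"
proof (rule ccontr)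
  interpret pair_fin_digraph D by fact
  assume "\<not> unilateral (with_proj D)"
  then obtain x y where xy: "x \<in> pverts D" "y \<in> pverts D"
      "\<not> x \<rightarrow>\<^sup>*\<^bsub>with_proj D\<^esub> y" "\<not> y \<rightarrow>\<^sup>*\<^bsub>with_proj D\<^esub> x"
    unfolding unilateral_def by auto
  have "\<not> unilateral (with_proj (token_digraph k D))"
  proof (rule not_unilateral_token_digraph[OF D, of "{x}" "{y}" k
        "{v. x \<rightarrow>\<^sup>*\<^bsub>with_proj D\<^esub> v}" "{v. y \<rightarrow>\<^sup>*\<^bsub>with_proj D\<^esub> v}"])
  qed (use xy k in \<open>auto intro: reachable_adj_trans\<close>)
  with uni show False by blast
qed

abbreviation strictly_before :: "('a, 'b) pre_digraph \<Rightarrow> 'a \<Rightarrow> 'a \<Rightarrow> bool" where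
  "strictly_before G u v \<equiv> u \<rightarrow>\<^sup>*\<^bsub>G\<^esub> v \<and> \<not> v \<rightarrow>\<^sup>*\<^bsub>G\<^esub> u"

text \<open>
  Tokens on \<open>x\<close>, \<open>z\<close> compete with tokens on \<open>v\<close>, \<open>w\<close>. Among what \<open>z\<close> reaches, the first pair has a
  token and the second has none. Among what \<open>v\<close> or \<open>w\<close> reaches, the second pair has two
  tokens and the first only the one on \<open>z\<close>.
\<close>
lemma not_unilateral_token_digraph_if_two_between:
  assumes D: "pair_fin_digraph D" and k: "2 \<le> k" "k + 2 \<le> card (pverts D)"
    and "v \<noteq> w"
    and "strictly_before (with_proj D) x v" "strictly_before (with_proj D) x w"
    and "strictly_before (with_proj D) v z" "strictly_before (with_proj D) w z"
  shows "\<not> unilateral (with_proj (token_digraph k D))"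
proof -
  interpret pair_fin_digraph D by fact
  have ver: "x \<in> pverts D" "v \<in> pverts D" "w \<in> pverts D" "z \<in> pverts D"
    using assms(5-) by (auto dest: reachable_in_verts)
  have ne: "x \<noteq> v" "x \<noteq> w" "z \<noteq> v" "z \<noteq> w" "x \<noteq> z"
    using assms(5-) ver by (auto dest: reachable_trans)
  have "card ({v, w} \<inter> {u. z \<rightarrow>\<^sup>*\<^bsub>with_proj D\<^esub> u}) = 0" using assms(5-) by auto
  moreover have "card ({x, z} \<inter> {u. z \<rightarrow>\<^sup>*\<^bsub>with_proj D\<^esub> u}) > 0"
    using ver by (auto simp: card_gt_0_iff)
  ultimately have up: "card ({v, w} \<inter> {u. z \<rightarrow>\<^sup>*\<^bsub>with_proj D\<^esub> u})
      < card ({x, z} \<inter> {u. z \<rightarrow>\<^sup>*\<^bsub>with_proj D\<^esub> u})" by simp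
  let ?W = "{u. v \<rightarrow>\<^sup>*\<^bsub>with_proj D\<^esub> u \<or> w \<rightarrow>\<^sup>*\<^bsub>with_proj D\<^esub> u}"
  have "{x, z} \<inter> ?W = {z}" "{v, w} \<inter> ?W = {v, w}" using assms(5-) ver by auto
  then have down: "card ({x, z} \<inter> ?W) < card ({v, w} \<inter> ?W)" using \<open>v \<noteq> w\<close> by simp
  show ?thesis
    by (rule not_unilateral_token_digraph[OF D _ _ _ _ _ _ _ up _ down])
      (use ver ne k \<open>v \<noteq> w\<close> in \<open>auto intro: reachable_adj_trans\<close>)
qed

section \<open>Matching vertices by rank\<close>

text \<open>
  Sort \<open>P\<close> and \<open>Q\<close> by rank, as \<open>ps\<close> and \<open>qs\<close>, and match equal positions. If the ranks at position
  \<open>i\<close> forbid the direction from \<open>P\<close> to \<open>Q\<close> and those at position \<open>j \<ge> i\<close> forbid the other, then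
  \<open>r (qs ! i) < r (ps ! i) \<le> r (ps ! j) < r (qs ! j)\<close>: both \<open>ps ! i\<close> and \<open>ps ! j\<close> have rank strictly
  between the ranks of two vertices of \<open>Q\<close>. If \<open>j < i\<close>, then \<open>P\<close> and \<open>Q\<close> change roles.
\<close>
lemma rank_matching:
  fixes r :: "'a \<Rightarrow> 'b::linorder"
  assumes "finite P" "finite Q" "card P = card Q"
    and no_two_between: "\<And>x v w z. \<lbrakk>{x, v, w, z} \<subseteq> P \<union> Q; r x < r v; r x < r w; r v < r z; r w < r z\<rbrakk> \<Longrightarrow> v = w"
  obtains f where "bij_betw f P Q" "\<And>p. p \<in> P \<Longrightarrow> r p \<le> r (f p)"
    | g where "bij_betw g Q P" "\<And>q. q \<in> Q \<Longrightarrow> r q \<le> r (g q)"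
proof -
  have "\<exists>xs. distinct xs \<and> set xs = X \<and> sorted (map r xs)" if fin: "finite X" for X :: "'a set"
  proof -
    obtain ys where "distinct ys" "set ys = X" using finite_distinct_list[OF fin] by blast
    then show ?thesis by (intro exI[of _ "sort_key r ys"]) simp
  qed
  from this[OF assms(1)] this[OF assms(2)]
  obtain ps qs where ps: "distinct ps" "set ps = P" "sorted (map r ps)"
    and qs: "distinct qs" "set qs = Q" "sorted (map r qs)"
    by blast
  have len: "length qs = length ps" using ps qs assms(3) distinct_card[of ps] distinct_card[of qs] by simp
  have matched: "\<exists>f. bij_betw f (set xs) (set ys) \<and> (\<forall>x \<in> set xs. r x \<le> r (f x))"
    if "distinct xs" "distinct ys" "length ys = length xs"
      "\<forall>i < length xs. r (xs ! i) \<le> r (ys ! i)" for xs ys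
  proof -
    have b1: "bij_betw ((!) xs) {..<length xs} (set xs)"
      and b2: "bij_betw ((!) ys) {..<length xs} (set ys)"
      using that by (simp_all add: bij_betw_nth)
    let ?f = "(!) ys \<circ> the_inv_into {..<length xs} ((!) xs)"
    have "bij_betw ?f (set xs) (set ys)"
      using bij_betw_trans[OF bij_betw_the_inv_into[OF b1] b2] .
    moreover have "r x \<le> r (?f x)" if x: "x \<in> set xs" for x
    proof -
      obtain i where i: "i < length xs" "x = xs ! i" using x by (metis in_set_conv_nth)
      then have "the_inv_into {..<length xs} ((!) xs) x = i"
        using the_inv_into_f_f[of "(!) xs" "{..<length xs}" i] b1 by (simp add: bij_betw_def)
      then show ?thesis using i \<open>\<forall>i < length xs. r (xs ! i) \<le> r (ys ! i)\<close> by simp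
    qed
    ultimately show ?thesis by blast
  qed
  \<comment> \<open>Stated for both orders of the lists, since either of them can supply the vertices in the middle.\<close>
  have clash: "xs ! i = xs ! j"
    if "i \<le> j" "j < length xs" "length ys = length xs" "set xs \<union> set ys = P \<union> Q"
      "sorted (map r xs)" "r (ys ! i) < r (xs ! i)" "r (xs ! j) < r (ys ! j)" for xs ys i j
  proof (rule no_two_between)
    have "r (xs ! i) \<le> r (xs ! j)"
      using sorted_nth_mono[OF that(5,1)] that(1,2) by simp
    then show "r (ys ! i) < r (xs ! i)" "r (ys ! i) < r (xs ! j)"
       "r (xs ! i) < r (ys ! j)" "r (xs ! j) < r (ys ! j)" using that(6,7) by (simp_all add: less_le_trans le_less_trans)
    show "{ys ! i, xs ! i, xs ! j, ys ! j} \<subseteq> P \<union> Q"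
      using that(1-3) unfolding that(4)[symmetric] by simp
  qed
  have "(\<forall>i < length ps. r (ps ! i) \<le> r (qs ! i)) \<or> (\<forall>i < length qs. r (qs ! i) \<le> r (ps ! i))"
  proof (rule ccontr)
    assume "\<not> ?thesis"
    then obtain i j where ij: "i < length ps" "j < length ps"
      "r (qs ! i) < r (ps ! i)" "r (ps ! j) < r (qs ! j)"
      using len by (auto simp: not_le)
    show False
    proof (cases "i \<le> j")
      case True
      then have "ps ! i = ps ! j"
        using ij ps qs len by (intro clash[of i j ps qs]) simp_all
      then have "i = j" using ps ij by (simp add: nth_eq_iff_index_eq)
      then show False using ij by simp
    next
      case False
      have "set qs \<union> set ps = P \<union> Q" using ps(2) qs(2) by auto
      then have "qs ! j = qs ! i"
        using False ij qs(3) len by (intro clash[of j i qs ps]) simp_all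
      then have "i = j" using qs ij len by (simp add: nth_eq_iff_index_eq)
      then show False using ij by simp
    qed
  qed
  then show thesis
  proof
    assume "\<forall>i < length ps. r (ps ! i) \<le> r (qs ! i)"
    then obtain f where "bij_betw f P Q" "\<forall>p \<in> P. r p \<le> r (f p)"
      using matched[of ps qs] ps qs len by auto
    then show thesis using that(1) by blast
  next
    assume "\<forall>i < length qs. r (qs ! i) \<le> r (ps ! i)"
    then obtain g where "bij_betw g Q P" "\<forall>q \<in> Q. r q \<le> r (g q)"
      using matched[of qs ps] ps qs len by auto
    then show thesis using that(2) by blast
  qed
qed

text \<open>
  The rank is any function that makes all vertices comparable; two configurations \<open>A\<close>, \<open>B\<close> are
  compared by matching \<open>A - B\<close> with \<open>B - A\<close> and transporting the tokens along the matching.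
\<close>
lemma unilateral_token_digraph:
  fixes r :: "'a \<Rightarrow> 'b::linorder"
  assumes D: "pair_fin_digraph D"
    and rank: "\<And>u v. u \<in> pverts D \<Longrightarrow> v \<in> pverts D \<Longrightarrow> r u \<le> r v \<Longrightarrow> u \<rightarrow>\<^sup>*\<^bsub>with_proj D\<^esub> v"
    and no_two_between: "\<And>x v w z. \<lbrakk>{x, v, w, z} \<subseteq> pverts D; r x < r v; r x < r w; r v < r z; r w < r z\<rbrakk> \<Longrightarrow> v = w"
  shows "unilateral (with_proj (token_digraph k D))"
  unfolding unilateral_def
proof (intro ballI)
  interpret pair_fin_digraph D by fact
  fix A B
  assume "A \<in> verts (with_proj (token_digraph k D))" "B \<in> verts (with_proj (token_digraph k D))"
  then have AB: "A \<subseteq> pverts D" "B \<subseteq> pverts D" "card A = k" "card B = k" by auto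
  have fin: "finite A" "finite B" using AB by (simp_all add: finite_subset[OF _ pair_finite_verts])
  have "card (A - B) = card (B - A)"
    using card_Diff_subset_Int[of A B] card_Diff_subset_Int[of B A] fin AB by (simp add: Int_commute)
  then consider f where "bij_betw f (A - B) (B - A)" "\<And>p. p \<in> A - B \<Longrightarrow> r p \<le> r (f p)"
    | g where "bij_betw g (B - A) (A - B)" "\<And>q. q \<in> B - A \<Longrightarrow> r q \<le> r (g q)"
    using rank_matching[of "A - B" "B - A" r] fin AB no_two_between
    by (smt (verit, ccfv_SIG) Diff_subset finite_Diff order_trans sup_least)
  then show "A \<rightarrow>\<^sup>*\<^bsub>with_proj (token_digraph k D)\<^esub> B \<or> B \<rightarrow>\<^sup>*\<^bsub>with_proj (token_digraph k D)\<^esub> A"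
  proof cases
    case 1
    have "a \<rightarrow>\<^sup>*\<^bsub>with_proj D\<^esub> f a" if "a \<in> A - B" for a
      using that 1 AB by (intro rank) (auto simp: bij_betw_def)
    then show ?thesis using token_transport[OF D AB(1,3,2) 1(1)] by blast
  next
    case 2
    have "a \<rightarrow>\<^sup>*\<^bsub>with_proj D\<^esub> g a" if "a \<in> B - A" for a
      using that 2 AB by (intro rank) (auto simp: bij_betw_def)
    then show ?thesis using token_transport[OF D AB(2,4,1) 2(1)] by blast
  qed
qed

section \<open>The position of a vertex in a topological order\<close>

text \<open>
  Arcs never decrease the position of the component, so neither do walks. Together with unilaterality
  this makes the position a rank that decides reachability.
\<close>
lemma scc_index:
  assumes "wf_digraph G" "topological_sccs G Cs"
  obtains idx where
    "\<And>u. u \<in> verts G \<Longrightarrow> idx u < length Cs \<and> u \<in> verts (Cs ! idx u)"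
    "\<And>u i. i < length Cs \<Longrightarrow> u \<in> verts (Cs ! i) \<Longrightarrow> u \<in> verts G \<and> idx u = i"
    "\<And>i. i < length Cs \<Longrightarrow> verts (Cs ! i) \<noteq> {}"
    "\<And>u v. u \<rightarrow>\<^sup>*\<^bsub>G\<^esub> v \<Longrightarrow> idx u \<le> idx v"
    "\<And>u v. u \<in> verts G \<Longrightarrow> v \<in> verts G \<Longrightarrow> idx u = idx v \<Longrightarrow> u \<rightarrow>\<^sup>*\<^bsub>G\<^esub> v"
proof -
  interpret wf_digraph G by fact
  have dist: "distinct Cs" and set: "set Cs = sccs"
    and topo: "\<And>i j u v. \<lbrakk>i < length Cs; j < length Cs; u \<in> verts (Cs ! i); v \<in> verts (Cs ! j);
      i \<noteq> j; u \<rightarrow>\<^bsub>G\<^esub> v\<rbrakk> \<Longrightarrow> i < j"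
    using assms(2) unfolding topological_sccs_def by blast+
  have comp: "verts (Cs ! i) \<in> sccs_verts" if "i < length Cs" for i
    using that set unfolding sccs_verts_conv by (metis imageI nth_mem)
  have "\<exists>i < length Cs. u \<in> verts (Cs ! i)" if "u \<in> verts G" for u
  proof -
    have "scc_of u \<in> verts ` set Cs"
      using scc_of_in_sccs_verts[OF that] by (simp add: sccs_verts_conv set)
    then show ?thesis using in_scc_of_self[OF that] by (metis imageE in_set_conv_nth)
  qed
  then obtain idx where idx: "\<And>u. u \<in> verts G \<Longrightarrow> idx u < length Cs \<and> u \<in> verts (Cs ! idx u)"
    by metis
  have uniq: "u \<in> verts G \<and> idx u = i" if i: "i < length Cs" "u \<in> verts (Cs ! i)" for u i
  proof -
    have u: "u \<in> verts G" using sccs_verts_subsets[OF comp[OF i(1)]] i by auto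
    then have "verts (Cs ! i) = verts (Cs ! idx u)"
      using sccs_verts_disjoint[OF comp[OF i(1)] comp] idx[OF u] i by blast
    then have "Cs ! i = Cs ! idx u"
      using inj_on_verts_sccs idx[OF u] i set by (metis inj_onD nth_mem)
    then show ?thesis using u idx[OF u] i dist by (simp add: nth_eq_iff_index_eq)
  qed
  show thesis
  proof (rule that[OF idx uniq])
    show "verts (Cs ! i) \<noteq> {}" if "i < length Cs" for i
      using comp[OF that] by (simp add: sccs_verts_def)
    show "idx u \<le> idx v" if "u \<rightarrow>\<^sup>*\<^bsub>G\<^esub> v" for u v
      using that
    proof (induction rule: reachable_induct)
      case (step v w)
      then have "idx v \<le> idx w"
        using topo[of "idx v" "idx w" v w] idx[of v] idx[of w]
        by (cases "idx v = idx w") (auto dest: reachable_in_verts adj_in_verts)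
      with step show ?case by simp
    qed simp
    show "u \<rightarrow>\<^sup>*\<^bsub>G\<^esub> v" if "u \<in> verts G" "v \<in> verts G" "idx u = idx v" for u v
      using comp[of "idx u"] idx[of u] idx[of v] that by (auto simp: sccs_verts_def)
  qed
qed

section \<open>Unilateral token digraphs\<close>

theorem theorem5p2:
  fixes D :: "'a pair_pre_digraph"
    and Cs :: "('a, 'a \<times> 'a) pre_digraph list"
    and n k t :: nat
  assumes "pair_digraph D"
    and "card (pverts D) = n"
    and "topological_sccs (with_proj D) Cs"
    and "length Cs = t"
    and "2 \<le> k" and "k \<le> n - 2"
  shows "unilateral (with_proj (token_digraph k D)) \<longleftrightarrow>
    unilateral (with_proj D) \<and> (t \<le> 2 \<or> t = 3 \<and> card (verts (Cs ! 1)) = 1)"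
proof -
  interpret pair_digraph D by fact
  have fin: "pair_fin_digraph D" by unfold_locales
  have wf: "wf_digraph (with_proj D)" by unfold_locales
  obtain idx where
    idx: "\<And>u. u \<in> pverts D \<Longrightarrow> idx u < t \<and> u \<in> verts (Cs ! idx u)"
    and uniq: "\<And>u i. i < t \<Longrightarrow> u \<in> verts (Cs ! i) \<Longrightarrow> u \<in> pverts D \<and> idx u = i"
    and nonempty: "\<And>i. i < t \<Longrightarrow> verts (Cs ! i) \<noteq> {}"
    and mono: "\<And>u v. u \<rightarrow>\<^sup>*\<^bsub>with_proj D\<^esub> v \<Longrightarrow> idx u \<le> idx v"
    and same: "\<And>u v. u \<in> pverts D \<Longrightarrow> v \<in> pverts D \<Longrightarrow> idx u = idx v \<Longrightarrow> u \<rightarrow>\<^sup>*\<^bsub>with_proj D\<^esub> v"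
    using scc_index[OF wf assms(3)] assms(4) by auto
  \<comment> \<open>If \<open>idx u \<le> idx v\<close> and \<open>u\<close> does not reach \<open>v\<close>, then \<open>v\<close> reaches \<open>u\<close>, so the positions are equal.\<close>
  have reach_iff: "u \<rightarrow>\<^sup>*\<^bsub>with_proj D\<^esub> v \<longleftrightarrow> idx u \<le> idx v"
    if "unilateral (with_proj D)" "u \<in> pverts D" "v \<in> pverts D" for u v
    using that same[of u v] mono[of u v] mono[of v u] unfolding unilateral_def
    by (metis le_antisym with_proj_simps(1))
  have one: "v = w" if "card (verts (Cs ! 1)) = 1" "1 < t" "idx v = 1" "idx w = 1"
      "v \<in> pverts D" "w \<in> pverts D" for v w
    using that idx[of v] idx[of w] by (auto simp: card_1_singleton_iff)
  show ?thesis
  proof (intro iffI conjI)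
    assume uniT: "unilateral (with_proj (token_digraph k D))"
    show uni: "unilateral (with_proj D)"
      using unilateral_of_token_digraph[OF fin _ _ uniT] assms by auto
    show "t \<le> 2 \<or> t = 3 \<and> card (verts (Cs ! 1)) = 1"
    proof (rule ccontr)
      assume bad: "\<not> ?thesis"
      \<comment> \<open>The components strictly between the first and the last have at least two vertices.\<close>
      have "\<exists>v w. v \<noteq> w \<and> v \<in> pverts D \<and> w \<in> pverts D
          \<and> 0 < idx v \<and> 0 < idx w \<and> idx v < t - 1 \<and> idx w < t - 1"
      proof (cases "t = 3")
        case True
        have "finite (verts (Cs ! 1))"
          using uniq[of 1] True pair_finite_verts by (meson finite_subset subsetI one_less_numeral_iff semiring_norm(77))
        then have "Suc 0 < card (verts (Cs ! 1))"
          using bad True nonempty[of 1] by (metis One_nat_def Suc_lessI card_gt_0_iff one_less_numeral_iff semiring_norm(77))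
        then obtain v w where "v \<in> verts (Cs ! 1)" "w \<in> verts (Cs ! 1)" "v \<noteq> w"
          by (metis card_le_Suc0_iff_eq card.infinite less_zeroE not_le)
        then show ?thesis using uniq[of 1] True by (intro exI[of _ v] exI[of _ w]) auto
      next
        case False
        with bad have t: "3 < t" by simp
        obtain v w where "v \<in> verts (Cs ! 1)" "w \<in> verts (Cs ! 2)"
          using nonempty[of 1] nonempty[of 2] t by auto
        then show ?thesis using uniq[of 1 v] uniq[of 2 w] t
          by (intro exI[of _ v] exI[of _ w]) auto
      qed
      then obtain v w where vw: "v \<noteq> w" "v \<in> pverts D" "w \<in> pverts D"
          "0 < idx v" "0 < idx w" "idx v < t - 1" "idx w < t - 1"
        by blast
      have "0 < t" "t - 1 < t" using bad by auto
      then obtain x z where "x \<in> pverts D" "idx x = 0" "z \<in> pverts D" "idx z = t - 1"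
        using nonempty uniq by (metis ex_in_conv)
      with vw have "\<not> unilateral (with_proj (token_digraph k D))"
        using assms
        by (intro not_unilateral_token_digraph_if_two_between[OF fin, of k v w x z])
          (auto simp: reach_iff[OF uni])
      with uniT show False by blast
    qed
  next
    assume R: "unilateral (with_proj D) \<and> (t \<le> 2 \<or> t = 3 \<and> card (verts (Cs ! 1)) = 1)"
    show "unilateral (with_proj (token_digraph k D))"
    proof (rule unilateral_token_digraph[OF fin])
      show "u \<rightarrow>\<^sup>*\<^bsub>with_proj D\<^esub> v" if "u \<in> pverts D" "v \<in> pverts D" "idx u \<le> idx v" for u v
        using that R reach_iff by blast
      show "v = w" if "{x, v, w, z} \<subseteq> pverts D" "idx x < idx v" "idx x < idx w"
        "idx v < idx z" "idx w < idx z" for x v w z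
      proof -
        have "idx z < t" using idx[of z] that by simp
        \<comment> \<open>Three different positions occur, and so \<open>t = 3\<close> and \<open>v\<close>, \<open>w\<close> lie in the middle component.\<close>
        with that R have "t = 3" "idx v = 1" "idx w = 1" "card (verts (Cs ! 1)) = 1" by auto
        then show ?thesis using one that by simp
      qed
    qed
  qed
qed

end
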